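(* Let $A\in\mathbb{R}^{n\times n}$ have all eigenvalues in the open unit disk and let $B\in\mathbb{R}^{n\times m}$. Let $N\geq n+m$ and for $i=1,\dots,N$ let $x_{i,1},x_{i,2}\in\mathbb{R}^{n}$, $u_{i,1}\in\mathbb{R}^{m}$ satisfy $x_{i,2}=Ax_{i,1}+Bu_{i,1}$. Put $X_{N,1}:=(x_{1,1},\dots,x_{N,1})^{\top}$, $X_{N,2}:=(x_{1,2},\dots,x_{N,2})^{\top}$ (in $\mathbb{R}^{N\times n}$), $U_{N,1}:=(u_{1,1},\dots,u_{N,1})^{\top}\in\mathbb{R}^{N\times m}$. Let $(Z_{N,2},Z_{B_{N,1}})\in\mathbb{R}^{N\times n}\times\mathbb{R}^{m\times N}$ be a solution of $X_{N,2}X_{N,1}^{\top}=X_{N,1}Z_{N,2}^{\top}+U_{N,1}Z_{B_{N,1}}$, and let $U_{B_{N,1}}\in\mathbb{R}^{N\times n}$ be a solution of $X_{N,1}U_{B_{N,1}}^{\top}=X_{N,1}X_{N,2}^{\top}-Z_{N,2}X_{N,1}^{\top}$. Let $\hat{A}\in\mathbb{R}^{r\times r}$, $\hat{B}\in\mathbb{R}^{r\times m}$, $\hat{C}\in\mathbb{R}^{n\times r}$, and assume: (a1) $(X_{N,1}^{\dagger}Z_{N,2},X_{N,1}^{\dagger}X_{N,1})$ is a regular matrix pencil; (a2) the spectra of $(X_{N,1}^{\dagger}Z_{N,2},X_{N,1}^{\dagger}X_{N,1})$ and $(I_r,\hat{A})$ are disjoint; (a3) $(X_{N,1}^{\dagger}(X_{N,2}-U_{B_{N,1}}),X_{N,1}^{\dagger}X_{N,1})$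 is a regular matrix pencil; (a4) the spectra of $(X_{N,1}^{\dagger}(X_{N,2}-U_{B_{N,1}}),X_{N,1}^{\dagger}X_{N,1})$ and $(I_r,\hat{A})$ are disjoint; (A2) every eigenvalue $\lambda$ of $\hat{A}$ satisfies $0<|\lambda|<1$; (b1) $\operatorname{rank}\begin{pmatrix}X_{N,1}&U_{N,1}\end{pmatrix}=n+m$; (b2) $\operatorname{rank}X_{N,1}=n$; (b3) $\operatorname{rank}U_{N,1}=m$. Let $P\in\mathbb{R}^{r\times r}$, $Q\in\mathbb{R}^{r\times r}$ be the solutions of $\hat{A}P\hat{A}^{\top}+\hat{B}\hat{B}^{\top}=P$ and $\hat{A}^{\top}Q\hat{A}+\hat{C}^{\top}\hat{C}=Q$. Let $R,S\in\mathbb{R}^{n\times r}$ satisfy $$X_{N,1}^{\dagger}Z_{N,2}R\hat{A}^{\top}+X_{N,1}^{\dagger}Z_{B_{N,1}}^{\top}\hat{B}^{\top}=X_{N,1}^{\dagger}X_{N,1}R,\qquad X_{N,1}^{\dagger}(X_{N,2}-U_{B_{N,1}})S\hat{A}-X_{N,1}^{\dagger}X_{N,1}\hat{C}=X_{N,1}^{\dagger}X_{N,1}S,$$ and let $S_B\in\mathbb{R}^{m\times r}$ satisfy $U_{N,1}S_{B}=U_{B_{N,1}}S$. Define $$\tilde{\nabla}_{\hat{A}}f:=2\big(Q\hat{A}P+(S^{\top}R-S_{B}^{\top}\hat{B}^{\top})(\hat{A}^{\dagger})^{\top}\big),\quad \tilde{\nabla}_{\hat{B}}f:=2(S_{B}^{\top}+Q\hat{B}),\quad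 \tilde{\nabla}_{\hat{C}}f:=2(\hat{C}P-R).$$ Let $R_*,S_*\in\mathbb{R}^{n\times r}$ be the solutions of $AR_*\hat{A}^{\top}+B\hat{B}^{\top}=R_*$ and $A^{\top}S_*\hat{A}-\hat{C}=S_*$. Then $$\tilde{\nabla}_{\hat{A}}f=\nabla_{\hat{A}}f=2(Q\hat{A}P+S_*^{\top}AR_* ),\quad \tilde{\nabla}_{\hat{B}}f=\nabla_{\hat{B}}f=2(S_*^{\top}B+Q\hat{B}),\quad \tilde{\nabla}_{\hat{C}}f=\nabla_{\hat{C}}f=2(\hat{C}P-R_* ).$$
   Context: $M^{\dagger}$ denotes the Moore–Penrose pseudoinverse. A pair $(M,K)$ of square matrices of equal size is a regular matrix pencil if $\det(M-\lambda K)$ is not identically zero in $\lambda$; its spectrum is the set of $\lambda\in\mathbb{C}$ with $\det(M-\lambda K)=0$, together with $\infty$ if $K$ is singular. The spectrum of $(I_r,\hat A)$ is the set of $\lambda\in\mathbb{C}$ with $\det(I_r-\lambda\hat A)=0$ (plus $\infty$ if $\hat A$ is singular). Background: for the system $x_{k+1}=Ax_k+Bu_k$, $y_k=x_k$ with transfer function $H(z)=(zI_n-A)^{-1}B$ and a reduced model with $H_r(z)=\hat{C}(zI_r-\hat{A})^{-1}\hat{B}$, $\hat A$ stable, one has $\|H-H_r\|_{h^2}^2=\operatorname{tr}(\Sigma_c)+f(\hat A,\hat B,\hat C)$ where $A\Sigma_cA^\top+BB^\top=\Sigma_c$ and $f(\hat{A},\hat{B},\hat{C})=\operatorname{tr}(\hat{C}P\hat{C}^{\top})-2\operatorname{tr}(R_*\hat{C}^{\top})$;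 by known results (Van Dooren et al.; Bunse-Gerstner et al.) the entrywise partial-derivative gradients $\nabla_{\hat A}f,\nabla_{\hat B}f,\nabla_{\hat C}f$ of $f$ are given by the formulas $2(Q\hat{A}P+S_*^{\top}AR_* )$, $2(S_*^{\top}B+Q\hat{B})$, $2(\hat{C}P-R_* )$. *)

theory Defs
  imports "HOL-Analysis.Analysis"
begin

text \<open>Complexification of a real matrix.\<close>
definition cmat :: "real^'n^'m \<Rightarrow> complex^'n^'m" where
  "cmat M = (\<chi> i j. complex_of_real (M$i$j))"

text \<open>Eigenvalues of a real square matrix (complex roots of the characteristic polynomial).\<close>
definition eigenvalues :: "real^'n^'n \<Rightarrow> complex set" where
  "eigenvalues M = {z. det (mat z - cmat M) = 0}"

text \<open>Moore--Penrose pseudoinverse: the unique matrix satisfying the four Penrose equations.\<close>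
definition pinv :: "real^'n^'m \<Rightarrow> real^'m^'n" where
  "pinv M = (THE X. M ** X ** M = M \<and> X ** M ** X = X \<and>
                    transpose (M ** X) = M ** X \<and> transpose (X ** M) = X ** M)"

text \<open>Regular matrix pencil (M,K): det(M - z K) not identically zero.\<close>
definition regular_pencil :: "real^'n^'n \<Rightarrow> real^'n^'n \<Rightarrow> bool" where
  "regular_pencil M K \<longleftrightarrow> (\<exists>z::complex. det (cmat M - mat z ** cmat K) \<noteq> 0)"

text \<open>Spectrum of a pencil (M,K); None stands for the point \<infinity>,
  which belongs to the spectrum iff K is singular.\<close>
definition pencil_spectrum :: "real^'n^'n \<Rightarrow> real^'n^'n \<Rightarrow> complex option set" where
  "pencil_spectrum M K =
     Some ` {z. det (cmat M - mat z ** cmat K) = 0} \<union> (if det K = 0 then {None} else {})"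

text \<open>Horizontal concatenation [X U].\<close>
definition hcat :: "real^'n^'k \<Rightarrow> real^'m^'k \<Rightarrow> real^('n + 'm)^'k" where
  "hcat X U = (\<chi> i j. case j of Inl a \<Rightarrow> X$i$a | Inr b \<Rightarrow> U$i$b)"

end

theory Submission
  imports Defs "HOL-Computational_Algebra.Fundamental_Theorem_Algebra"
begin

(* Under the rank conditions the data determine the model exactly: writing the data equations
   as X2 = X1 A^T + U1 B^T, injectivity of [X1 U1] and of X1 forces Z2 = X1 A, ZB = B^T X1^T and
   UB = U1 B^T, while pinv X1 ** X1 = I.  The equations defining R and S therefore become the
   Stein equations A R Ahat^T + B Bhat^T = R and A^T S Ahat - Chat = S, which also define Rs and Ss.
   A Stein equation D = A D M with M invertible has only the trivial homogeneous solution when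
   A and M^-1 share no eigenvalue: a nonzero solution of the Sylvester equation A D = D M^-1
   produces, through a least-degree polynomial annihilating a vector under M^-1, a common
   eigenvalue, which is excluded since |eig A| < 1 < |eig M^-1|.  So R = Rs, S = Ss, SB = B^T S,
   and Ahat is invertible because 0 is not an eigenvalue, which turns each gradient formula into
   the other. *)

lemma matrix_diff_ldistrib: "(A::'a::ring_1^'n^'m) ** (B - C) = A ** B - A ** C"
  by (simp add: matrix_matrix_mult_def vec_eq_iff sum_subtractf[symmetric] algebra_simps)

lemma matrix_diff_rdistrib: "((B::'a::ring_1^'n^'m) - C) ** A = B ** A - C ** A"
  by (simp add: matrix_matrix_mult_def vec_eq_iff sum_subtractf[symmetric] algebra_simps)

lemma matrix_add_rdistrib: "((B::'a::semiring_1^'n^'m) + C) ** A = B ** A + C ** A"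
  by (simp add: matrix_matrix_mult_def vec_eq_iff sum.distrib[symmetric] algebra_simps)

lemma transpose_add: "transpose (A + B) = transpose A + transpose (B::'a::plus^'n^'m)"
  by (simp add: transpose_def vec_eq_iff)

lemma transpose_diff: "transpose (A - B) = transpose A - transpose (B::'a::minus^'n^'m)"
  by (simp add: transpose_def vec_eq_iff)

lemma matrix_mul_left_cancel:
  fixes X :: "'a::field^'n^'m"
  assumes "inj ((*v) X)" and "X ** P = X ** Q"
  shows "P = Q"
proof -
  obtain L where L: "L ** X = mat 1"
    using assms(1) matrix_left_invertible_injective by blast
  have "P = L ** (X ** P)" by (simp add: matrix_mul_assoc L)
  also have "\<dots> = Q" by (simp add: assms(2) matrix_mul_assoc L)
  finally show ?thesis .
qed

lemma det_eq_0_iff_kernel: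
  fixes M :: "'a::field^'n^'n"
  shows "det M = 0 \<longleftrightarrow> (\<exists>z. z \<noteq> 0 \<and> M *v z = 0)"
  by (metis invertible_det_nz invertible_left_inverse matrix_left_invertible_ker)

(* p(K) v, by Horner's scheme *)
definition poly_mv :: "'a::comm_ring_1 poly \<Rightarrow> 'a^'n^'n \<Rightarrow> 'a^'n \<Rightarrow> 'a^'n" where
  "poly_mv p K v = fold_coeffs (\<lambda>a u. a *s v + K *v u) p 0"

lemma poly_mv_0 [simp]: "poly_mv 0 K v = 0"
  by (simp add: poly_mv_def)

lemma poly_mv_pCons [simp]: "poly_mv (pCons a p) K v = a *s v + K *v poly_mv p K v"
  by (cases "a = 0 \<and> p = 0") (auto simp: poly_mv_def fold_coeffs_def cCons_def)

lemma poly_mv_add: "poly_mv (p + q) K v = poly_mv p K v + poly_mv q K v"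
proof (induction p arbitrary: q rule: pCons_induct)
  case (pCons a p)
  obtain b q' where "q = pCons b q'" by (cases q rule: pCons_cases)
  then show ?case
    by (simp add: pCons.IH vector_sadd_rdistrib matrix_vector_right_distrib algebra_simps)
qed simp

lemma poly_mv_smult: "poly_mv (smult c p) K v = c *s poly_mv p (K::'a::field^'n^'n) v"
  by (induction p rule: pCons_induct)
    (simp_all add: vector_add_ldistrib vector_smult_assoc vector_scalar_commute)

lemma poly_mv_diff: "poly_mv (p - q) K v = poly_mv p (K::'a::field^'n^'n) v - poly_mv q K v"
proof -
  have "p - q = p + smult (-1) q" by simp
  then show ?thesis by (simp only: poly_mv_add poly_mv_smult) simp
qed

lemma poly_mv_mult: "poly_mv (p * q) K v = poly_mv p (K::'a::field^'n^'n) (poly_mv q K v)"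
  by (induction p rule: pCons_induct) (simp_all add: poly_mv_add poly_mv_smult)

lemma poly_mv_sum: "poly_mv (sum f S) K v = (\<Sum>x\<in>S. poly_mv (f x) K v)"
  by (induction S rule: infinite_finite_induct) (simp_all add: poly_mv_add)

lemma poly_mv_monom: "poly_mv (monom c j) (K::'a::field^'n^'n) v = c *s (((*v) K ^^ j) v)"
  by (induction j) (simp_all add: monom_0 monom_Suc vector_scalar_commute)

lemma poly_mv_linear: "poly_mv [:-\<mu>, 1:] K v = K *v v - \<mu> *s (v::'a::comm_ring_1^'n)"
  by (simp add: vector_smult_lneg)

lemma poly_mv_intertwine:
  assumes "A ** D = D ** K"
  shows "poly_mv p A (D *v w) = D *v poly_mv p (K::'a::field^'r^'r) w"
  by (induction p rule: pCons_induct)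
    (simp_all add: matrix_vector_mul_assoc assms matrix_vector_right_distrib vector_scalar_commute)

lemma poly_mv_annihilator_exists:
  fixes K :: "'a::field^'n^'n"
  shows "\<exists>p. p \<noteq> 0 \<and> poly_mv p K w = 0"
proof -
  define n where "n = CARD('n)"
  define u where "u j = ((*v) K ^^ j) w" for j
  show ?thesis
  proof (cases "inj_on u {..n}")
    case False
    then obtain i j where ij: "i \<noteq> j" "u i = u j" by (auto simp: inj_on_def)
    define p where "p = monom (1::'a) i - monom 1 j"
    have "coeff p i = 1" using ij by (simp add: p_def coeff_monom)
    then have "p \<noteq> 0" by auto
    moreover have "poly_mv p K w = 0"
      using ij by (simp add: p_def poly_mv_diff poly_mv_monom u_def)
    ultimately show ?thesis by blast
  next
    case True
    define S where "S = u ` {..n}"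
    have "card S = Suc n" using True by (simp add: S_def card_image)
    then have "vec.dependent S"
      using vec.dim_subset[of S UNIV]
      by (intro vec.dependent_biggerset_general) (simp add: n_def card_cart_basis)
    then obtain c where c: "\<exists>v\<in>S. c v \<noteq> 0" "(\<Sum>v\<in>S. c v *s v) = 0"
      using vec.dependent_finite[of S] unfolding S_def by blast
    define p where "p = (\<Sum>j\<le>n. monom (c (u j)) j)"
    from c(1) obtain j where "j \<le> n" "c (u j) \<noteq> 0" by (auto simp: S_def)
    then have "coeff p j \<noteq> 0" by (simp add: p_def coeff_sum coeff_monom)
    then have "p \<noteq> 0" by auto
    moreover have "poly_mv p K w = (\<Sum>j\<le>n. c (u j) *s u j)"
      by (simp add: p_def poly_mv_sum poly_mv_monom u_def)
    moreover have "\<dots> = (\<Sum>v\<in>S. c v *s v)"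
      unfolding S_def by (subst sum.reindex[OF True]) simp
    ultimately show ?thesis using c(2) by auto
  qed
qed

lemma poly_root_linear_factor:
  fixes p :: "'a::idom poly"
  assumes "p \<noteq> 0" "poly p \<mu> = 0"
  obtains q where "p = [:-\<mu>, 1:] * q" "q \<noteq> 0" "degree q < degree p"
proof -
  obtain q where pq: "p = [:-\<mu>, 1:] * q"
    using assms(2) poly_eq_0_iff_dvd by (metis dvdE)
  with assms(1) have "q \<noteq> 0" by auto
  then have "degree p = Suc (degree q)"
    unfolding pq by (subst degree_mult_eq) auto
  with pq \<open>q \<noteq> 0\<close> show ?thesis using that by simp
qed

lemma poly_mv_annihilator_root_eigenvector:
  fixes A :: "complex^'n^'n"
  assumes "p \<noteq> 0" "y \<noteq> 0" "poly_mv p A y = 0"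
  shows "\<exists>\<mu> z. poly p \<mu> = 0 \<and> z \<noteq> 0 \<and> A *v z = \<mu> *s z"
  using assms
proof (induction "degree p" arbitrary: p y rule: less_induct)
  case less
  show ?case
  proof (cases "degree p = 0")
    case True
    then obtain c where "p = [:c:]" by (rule degree_eq_zeroE)
    with less.prems show ?thesis by auto
  next
    case False
    then obtain \<mu> where \<mu>: "poly p \<mu> = 0"
      by (metis fundamental_theorem_of_algebra constant_degree)
    then obtain q where pq: "p = [:-\<mu>, 1:] * q" and q0: "q \<noteq> 0" and "degree q < degree p"
      using poly_root_linear_factor less.prems(1) by blast
    define z where "z = poly_mv [:-\<mu>, 1:] A y"
    have "poly_mv q A z = poly_mv p A y"
      unfolding pq z_def by (simp only: mult.commute[of "[:-\<mu>, 1:]"] poly_mv_mult)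
    with less.prems(3) have "poly_mv q A z = 0" by simp
    show ?thesis
    proof (cases "z = 0")
      case True
      then have "A *v y = \<mu> *s y" by (simp add: z_def poly_mv_linear)
      with \<mu> less.prems(2) show ?thesis by blast
    next
      case False
      with less.hyps[OF \<open>degree q < degree p\<close> q0] \<open>poly_mv q A z = 0\<close>
      obtain \<nu> z' where "poly q \<nu> = 0" "z' \<noteq> 0" "A *v z' = \<nu> *s z'" by blast
      then show ?thesis by (auto simp: pq)
    qed
  qed
qed

lemma minimal_annihilator_root_eigenvalue:
  fixes K :: "'a::field^'n^'n"
  assumes p: "p \<noteq> 0" "poly_mv p K w = 0"
    and minimal: "\<And>q. q \<noteq> 0 \<Longrightarrow> poly_mv q K w = 0 \<Longrightarrow> degree p \<le> degree q"
    and root: "poly p \<mu> = 0"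
  shows "\<exists>z. z \<noteq> 0 \<and> K *v z = \<mu> *s z"
proof -
  obtain q where pq: "p = [:-\<mu>, 1:] * q" and "q \<noteq> 0" "degree q < degree p"
    using poly_root_linear_factor p(1) root by blast
  then have "poly_mv q K w \<noteq> 0" using minimal \<open>q \<noteq> 0\<close> by fastforce
  moreover have "poly_mv [:-\<mu>, 1:] K (poly_mv q K w) = poly_mv p K w"
    unfolding pq by (simp only: poly_mv_mult)
  ultimately show ?thesis using p(2) by (auto simp: poly_mv_linear)
qed

lemma sylvester_homogeneous_zero:
  fixes A :: "complex^'n^'n" and K :: "complex^'r^'r" and D :: "complex^'r^'n"
  assumes AD: "A ** D = D ** K"
    and disjoint: "\<And>\<mu> y z. A *v y = \<mu> *s y \<Longrightarrow> K *v z = \<mu> *s z \<Longrightarrow> y = 0 \<or> z = 0"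
  shows "D = 0"
proof -
  have "D *v w = 0" for w
  proof (rule ccontr)
    assume Dw: "D *v w \<noteq> 0"
    let ?annihilates = "\<lambda>d. \<exists>p. p \<noteq> 0 \<and> poly_mv p K w = 0 \<and> degree p = d"
    obtain d where "?annihilates d" and least: "\<And>d'. d' < d \<Longrightarrow> \<not> ?annihilates d'"
      using poly_mv_annihilator_exists[of K w] exists_least_iff[of ?annihilates] by blast
    then obtain p where p: "p \<noteq> 0" "poly_mv p K w = 0" and "degree p = d" by blast
    then have minimal: "degree p \<le> degree q" if "q \<noteq> 0" "poly_mv q K w = 0" for q
      using least that \<open>degree p = d\<close> by (metis not_le)
    have "poly_mv p A (D *v w) = 0" by (simp add: poly_mv_intertwine[OF AD] p(2))
    then obtain \<mu> y where "poly p \<mu> = 0" "y \<noteq> 0" "A *v y = \<mu> *s y"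
      using poly_mv_annihilator_root_eigenvector[OF p(1) Dw] by blast
    moreover obtain z where "z \<noteq> 0" "K *v z = \<mu> *s z"
      using minimal_annihilator_root_eigenvalue[OF p minimal \<open>poly p \<mu> = 0\<close>] by blast
    ultimately show False using disjoint by blast
  qed
  then show ?thesis by (simp add: matrix_eq)
qed

lemma cmat_mult: "cmat (X ** Y) = cmat X ** cmat Y"
  by (simp add: cmat_def matrix_matrix_mult_def vec_eq_iff)

lemma cmat_transpose: "cmat (transpose X) = transpose (cmat X)"
  by (simp add: cmat_def transpose_def vec_eq_iff)

lemma cmat_eq_0_iff: "cmat X = 0 \<longleftrightarrow> X = 0"
  by (simp add: cmat_def vec_eq_iff)

lemma det_cmat: "det (cmat M) = complex_of_real (det M)"
  by (simp add: det_def cmat_def)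

lemma mat_mult_vector: "mat c *v y = c *s (y::'a::semiring_1^'n)"
  by (simp add: vec_eq_iff matrix_vector_mult_def mat_def if_distrib if_distribR cong: if_cong)

lemma eigenvalues_iff_eigenvector:
  "\<mu> \<in> eigenvalues M \<longleftrightarrow> (\<exists>y. y \<noteq> 0 \<and> cmat M *v y = \<mu> *s y)"
proof -
  have "(mat \<mu> - cmat M) *v y = \<mu> *s y - cmat M *v y" for y
    by (simp add: matrix_vector_mult_diff_rdistrib mat_mult_vector)
  then show ?thesis
    by (simp add: eigenvalues_def det_eq_0_iff_kernel eq_commute[of "cmat M *v _"])
qed

lemma zero_in_eigenvalues_iff: "0 \<in> eigenvalues M \<longleftrightarrow> det M = 0"
proof -
  have "det M = 0 \<longleftrightarrow> det (cmat M) = 0" by (simp add: det_cmat)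
  then show ?thesis
    by (simp add: eigenvalues_iff_eigenvector det_eq_0_iff_kernel[of "cmat M"])
qed

lemma eigenvalues_transpose: "eigenvalues (transpose M) = eigenvalues M"
proof -
  have "mat z - cmat (transpose M) = transpose (mat z - cmat M)" for z
    by (simp add: cmat_transpose transpose_diff)
  then show ?thesis by (simp add: eigenvalues_def)
qed

lemma stein_homogeneous_zero:
  fixes A :: "real^'n^'n" and M :: "real^'r^'r" and D :: "real^'r^'n"
  assumes A: "\<forall>z\<in>eigenvalues A. norm z < 1"
    and M: "\<forall>z\<in>eigenvalues M. 0 < norm z \<and> norm z < 1"
    and D: "D = A ** D ** M"
  shows "D = 0"
proof -
  have "det (cmat M) \<noteq> 0"
    using M zero_in_eigenvalues_iff[of M] by (auto simp: det_cmat)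
  then obtain K where K: "cmat M ** K = mat 1" "K ** cmat M = mat 1"
    by (metis invertible_det_nz invertible_def)
  have "cmat A ** cmat D = cmat D ** K"
  proof -
    have "cmat D ** K = cmat A ** cmat D ** (cmat M ** K)"
      by (subst D) (simp add: cmat_mult matrix_mul_assoc)
    then show ?thesis using K by simp
  qed
  moreover have "y = 0 \<or> z = 0" if y: "cmat A *v y = \<mu> *s y" and z: "K *v z = \<mu> *s z" for \<mu> y z
  proof (rule ccontr)
    assume "\<not> (y = 0 \<or> z = 0)"
    then have "\<mu> \<in> eigenvalues A" "z \<noteq> 0"
      using y by (auto simp: eigenvalues_iff_eigenvector)
    have "z = cmat M *v (K *v z)" by (simp add: matrix_vector_mul_assoc K)
    also have "\<dots> = \<mu> *s (cmat M *v z)" by (simp add: z vector_scalar_commute)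
    finally have z_eq: "z = \<mu> *s (cmat M *v z)" .
    with \<open>z \<noteq> 0\<close> have "\<mu> \<noteq> 0" by auto
    with z_eq have "cmat M *v z = inverse \<mu> *s z"
      by (metis vector_smult_assoc left_inverse vector_smult_lid)
    then have "inverse \<mu> \<in> eigenvalues M"
      using \<open>z \<noteq> 0\<close> by (auto simp: eigenvalues_iff_eigenvector)
    then have "norm (inverse \<mu>) < 1" using M by blast
    moreover have "norm \<mu> < 1" using A \<open>\<mu> \<in> eigenvalues A\<close> by blast
    ultimately show False
      using \<open>\<mu> \<noteq> 0\<close> by (simp add: norm_inverse inverse_less_1_iff)
  qed
  ultimately have "cmat D = 0" by (rule sylvester_homogeneous_zero)
  then show ?thesis by (simp add: cmat_eq_0_iff)
qed

lemma stein_solution_unique: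
  fixes A :: "real^'n^'n" and M :: "real^'r^'r" and X Y C :: "real^'r^'n"
  assumes "\<forall>z\<in>eigenvalues A. norm z < 1"
    and "\<forall>z\<in>eigenvalues M. 0 < norm z \<and> norm z < 1"
    and "A ** X ** M + C = X" and "A ** Y ** M + C = Y"
  shows "X = Y"
proof -
  have "X - Y = A ** (X - Y) ** M"
    by (metis assms(3,4) add_diff_cancel_right matrix_diff_ldistrib matrix_diff_rdistrib)
  with assms(1,2) have "X - Y = 0" by (rule stein_homogeneous_zero)
  then show ?thesis by simp
qed

definition moore_penrose :: "'a::comm_ring_1^'n^'m \<Rightarrow> 'a^'m^'n \<Rightarrow> bool" where
  "moore_penrose X Y \<longleftrightarrow> X ** Y ** X = X \<and> Y ** X ** Y = Y \<and>
     transpose (X ** Y) = X ** Y \<and> transpose (Y ** X) = Y ** X"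

lemma moore_penrose_unique:
  assumes Y: "moore_penrose X Y" and G: "moore_penrose X G"
  shows "Y = G"
proof -
  have XG: "transpose X = transpose X ** X ** G"
    using G unfolding moore_penrose_def
    by (metis matrix_transpose_mul matrix_mul_assoc)
  have XY: "transpose X = Y ** X ** transpose X"
    using Y unfolding moore_penrose_def
    by (metis matrix_transpose_mul matrix_mul_assoc)
  have "Y = Y ** transpose Y ** transpose X"
    using Y unfolding moore_penrose_def
    by (metis matrix_transpose_mul matrix_mul_assoc)
  also have "\<dots> = Y ** X ** G"
    using Y unfolding moore_penrose_def
    by (metis XG matrix_transpose_mul matrix_mul_assoc)
  also have "\<dots> = transpose X ** transpose G ** G"
    using G unfolding moore_penrose_def
    by (metis XY matrix_transpose_mul matrix_mul_assoc)
  also have "\<dots> = G"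
    using G unfolding moore_penrose_def
    by (metis matrix_transpose_mul matrix_mul_assoc)
  finally show ?thesis .
qed

lemma pinv_eqI: "moore_penrose X G \<Longrightarrow> pinv X = G"
  unfolding pinv_def moore_penrose_def[symmetric]
  by (rule the_equality) (auto intro: moore_penrose_unique)

lemma pinv_left_inverse:
  fixes X :: "real^'a^'b"
  assumes inj: "inj ((*v) X)"
  shows "pinv X ** X = mat 1"
proof -
  define T where "T = transpose X ** X"
  have "x = 0" if "T *v x = 0" for x
  proof -
    have "inner (X *v x) (X *v x) = inner ((X *v x) v* X) x"
      by (simp add: dot_lmul_matrix)
    also have "(X *v x) v* X = T *v x"
      by (simp add: T_def matrix_vector_mul_assoc[symmetric])
    finally have "X *v x = 0" using that by simp
    then show "x = 0" using inj by (metis injD matrix_vector_mult_0_right)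
  qed
  then obtain Ti where Ti: "Ti ** T = mat 1"
    using matrix_left_invertible_ker[of T] by blast
  then have "T ** Ti = mat 1" using matrix_left_right_inverse by blast
  moreover have "transpose T = T" by (simp add: T_def matrix_transpose_mul)
  ultimately have "transpose Ti = Ti"
    by (metis Ti matrix_transpose_mul transpose_mat matrix_mul_assoc matrix_mul_lid matrix_mul_rid)
  define G where "G = Ti ** transpose X"
  have GX: "G ** X = mat 1" using Ti by (simp add: G_def T_def matrix_mul_assoc)
  moreover have "transpose (X ** G) = X ** G"
    by (simp add: G_def matrix_transpose_mul \<open>transpose Ti = Ti\<close> matrix_mul_assoc)
  ultimately have "moore_penrose X G"
    by (simp add: moore_penrose_def matrix_mul_assoc[symmetric])
  then show ?thesis using GX by (simp add: pinv_eqI)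
qed

lemma pinv_left_inverse_nonsingular:
  fixes M :: "real^'n^'n"
  assumes "det M \<noteq> 0"
  shows "pinv M ** M = mat 1"
  using assms pinv_left_inverse
  by (metis invertible_det_nz invertible_left_inverse matrix_left_invertible_injective)

definition vcat :: "real^'k^'n \<Rightarrow> real^'k^'m \<Rightarrow> real^'k^('n + 'm)" where
  "vcat Y W = (\<chi> i. case i of Inl a \<Rightarrow> Y$a | Inr b \<Rightarrow> W$b)"

lemma hcat_mult_vcat:
  fixes X :: "real^'n^'k" and U :: "real^'m^'k"
  shows "hcat X U ** vcat Y W = X ** Y + U ** W"
proof -
  have "sum f UNIV = sum (f \<circ> Inl) UNIV + sum (f \<circ> Inr) UNIV" for f :: "'n + 'm \<Rightarrow> real"
    by (metis UNIV_Plus_UNIV finite sum.Plus)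
  then show ?thesis
    by (simp add: vec_eq_iff matrix_matrix_mult_def hcat_def vcat_def)
qed

lemma vcat_eq_0_iff: "vcat Y W = 0 \<longleftrightarrow> Y = 0 \<and> W = 0"
  by (auto simp: vcat_def vec_eq_iff split: sum.splits)

lemma hcat_mult_eq_0_cancel:
  assumes "inj ((*v) (hcat X U))" and "X ** Y + U ** W = 0"
  shows "Y = 0" and "W = 0"
proof -
  have "hcat X U ** vcat Y W = hcat X U ** 0"
    using assms(2) by (simp add: hcat_mult_vcat)
  then have "vcat Y W = 0" by (rule matrix_mul_left_cancel[OF assms(1)])
  then show "Y = 0" and "W = 0" by (simp_all add: vcat_eq_0_iff)
qed

lemma data_matrix_eq:
  assumes "\<forall>i. X2$i = A *v (X1$i) + B *v (U1$i)"
  shows "X2 = X1 ** transpose A + U1 ** transpose (B::'a::comm_semiring_1^'m^'n)"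
  using assms
  by (simp add: vec_eq_iff matrix_matrix_mult_def matrix_vector_mult_def transpose_def mult.commute)

lemma data_equation_solutions:
  fixes A :: "real^'n^'n" and B :: "real^'m^'n" and X1 :: "real^'n^'N" and U1 :: "real^'m^'N"
  assumes X2: "X2 = X1 ** transpose A + U1 ** transpose B"
    and Zsol: "X2 ** transpose X1 = X1 ** transpose Z2 + U1 ** ZB"
    and UBsol: "X1 ** transpose UB = X1 ** transpose X2 - Z2 ** transpose X1"
    and inj_XU: "inj ((*v) (hcat X1 U1))" and inj_X: "inj ((*v) X1)"
  shows "Z2 = X1 ** A" and "transpose ZB = X1 ** B" and "UB = U1 ** transpose B"
proof -
  have "X1 ** (transpose A ** transpose X1 - transpose Z2) + U1 ** (transpose B ** transpose X1 - ZB) = 0"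
    using Zsol by (simp add: X2 matrix_add_rdistrib matrix_diff_ldistrib matrix_mul_assoc algebra_simps)
  from hcat_mult_eq_0_cancel[OF inj_XU this]
  have Z2t: "transpose Z2 = transpose A ** transpose X1" and ZB: "ZB = transpose B ** transpose X1"
    by simp_all
  show Z2: "Z2 = X1 ** A"
    by (metis Z2t matrix_transpose_mul transpose_transpose)
  show "transpose ZB = X1 ** B"
    by (simp add: ZB matrix_transpose_mul)
  have "X1 ** transpose UB = X1 ** (B ** transpose U1)"
    using UBsol
    by (simp add: X2 Z2 transpose_add matrix_transpose_mul matrix_add_ldistrib matrix_mul_assoc)
  then have "transpose UB = B ** transpose U1" by (rule matrix_mul_left_cancel[OF inj_X])
  then show "UB = U1 ** transpose B"
    by (metis matrix_transpose_mul transpose_transpose)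
qed

theorem theorem1:
  fixes A :: "real^'n^'n" and B :: "real^'m^'n"
    and X1 X2 :: "real^'n^'N" and U1 :: "real^'m^'N"
    and Z2 :: "real^'n^'N" and ZB :: "real^'N^'m" and UB :: "real^'n^'N"
    and Ahat :: "real^'r^'r" and Bhat :: "real^'m^'r" and Chat :: "real^'r^'n"
    and P Q :: "real^'r^'r" and R S :: "real^'r^'n" and SB :: "real^'r^'m"
    and Rs Ss :: "real^'r^'n"
  assumes A_stable: "\<forall>z\<in>eigenvalues A. norm z < 1"
    and N_ge: "CARD('N) \<ge> CARD('n) + CARD('m)"
    and data: "\<forall>i. X2$i = A *v (X1$i) + B *v (U1$i)"
    and Zsol: "X2 ** transpose X1 = X1 ** transpose Z2 + U1 ** ZB"
    and UBsol: "X1 ** transpose UB = X1 ** transpose X2 - Z2 ** transpose X1"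
    and a1: "regular_pencil (pinv X1 ** Z2) (pinv X1 ** X1)"
    and a2: "pencil_spectrum (pinv X1 ** Z2) (pinv X1 ** X1) \<inter> pencil_spectrum (mat 1) Ahat = {}"
    and a3: "regular_pencil (pinv X1 ** (X2 - UB)) (pinv X1 ** X1)"
    and a4: "pencil_spectrum (pinv X1 ** (X2 - UB)) (pinv X1 ** X1) \<inter> pencil_spectrum (mat 1) Ahat = {}"
    and A2: "\<forall>z\<in>eigenvalues Ahat. 0 < norm z \<and> norm z < 1"
    and b1: "rank (hcat X1 U1) = CARD('n) + CARD('m)"
    and b2: "rank X1 = CARD('n)"
    and b3: "rank U1 = CARD('m)"
    and Psol: "Ahat ** P ** transpose Ahat + Bhat ** transpose Bhat = P"
    and Qsol: "transpose Ahat ** Q ** Ahat + transpose Chat ** Chat = Q"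
    and Rsol: "pinv X1 ** Z2 ** R ** transpose Ahat + pinv X1 ** transpose ZB ** transpose Bhat
                 = pinv X1 ** X1 ** R"
    and Ssol: "pinv X1 ** (X2 - UB) ** S ** Ahat - pinv X1 ** X1 ** Chat = pinv X1 ** X1 ** S"
    and SBsol: "U1 ** SB = UB ** S"
    and Rssol: "A ** Rs ** transpose Ahat + B ** transpose Bhat = Rs"
    and Sssol: "transpose A ** Ss ** Ahat - Chat = Ss"
  shows "2 *\<^sub>R (Q ** Ahat ** P + (transpose S ** R - transpose SB ** transpose Bhat) ** transpose (pinv Ahat))
           = 2 *\<^sub>R (Q ** Ahat ** P + transpose Ss ** A ** Rs)
         \<and> 2 *\<^sub>R (transpose SB + Q ** Bhat) = 2 *\<^sub>R (transpose Ss ** B + Q ** Bhat)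
         \<and> 2 *\<^sub>R (Chat ** P - R) = 2 *\<^sub>R (Chat ** P - Rs)"
proof -
  have inj_X1: "inj ((*v) X1)" and inj_U1: "inj ((*v) U1)"
    using b2 b3 full_rank_injective by blast+
  have "inj ((*v) (hcat X1 U1))"
    using b1 full_rank_injective[of "hcat X1 U1"] by (simp add: card_sum)
  note X2 = data_matrix_eq[OF data]
  note identified = data_equation_solutions[OF X2 Zsol UBsol \<open>inj ((*v) (hcat X1 U1))\<close> inj_X1]
  have GX: "pinv X1 ** X1 = mat 1" by (rule pinv_left_inverse[OF inj_X1])
  have R_stein: "A ** R ** transpose Ahat + B ** transpose Bhat = R"
    using Rsol by (simp add: identified GX matrix_mul_assoc)
  then have R: "R = Rs"
    using stein_solution_unique[OF A_stable _ _ Rssol] A2 by (simp add: eigenvalues_transpose)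
  have "transpose A ** S ** Ahat + - Chat = S"
    using Ssol by (simp add: X2 identified GX matrix_mul_assoc)
  then have S: "S = Ss"
    using stein_solution_unique[OF _ A2 _ Sssol[unfolded diff_conv_add_uminus]] A_stable
    by (simp add: eigenvalues_transpose)
  have SB: "transpose SB = transpose S ** B"
    using SBsol matrix_mul_left_cancel[OF inj_U1, of SB "transpose B ** S"]
    by (simp add: identified matrix_mul_assoc matrix_transpose_mul)
  have "det Ahat \<noteq> 0" using A2 zero_in_eigenvalues_iff by force
  then have Ahat_inverse: "transpose Ahat ** transpose (pinv Ahat) = mat 1"
    by (metis pinv_left_inverse_nonsingular matrix_transpose_mul transpose_mat)
  have "transpose S ** R = transpose S ** (A ** R ** transpose Ahat + B ** transpose Bhat)"
    by (simp only: R_stein)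
  then have "transpose S ** R - transpose SB ** transpose Bhat = transpose S ** A ** R ** transpose Ahat"
    by (simp add: SB matrix_add_ldistrib matrix_mul_assoc)
  then have "(transpose S ** R - transpose SB ** transpose Bhat) ** transpose (pinv Ahat)
      = transpose S ** A ** R"
    by (simp add: Ahat_inverse flip: matrix_mul_assoc)
  then show ?thesis using R S SB by simp
qed

end
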